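(* Let $m \geq 2$ be an integer and let $\boldsymbol{\alpha} \in (0,\infty)^m$. The parameters $\boldsymbol{\alpha}$ may be recovered, up to permuting the entries, from the first $m$ moments $\mu_1, \ldots, \mu_m$ of the density $\Lambda_{\boldsymbol{\alpha}}$, and also from the lowest $m+1$ non-trivial Maclaurin coefficients of $\Lambda_{\boldsymbol{\alpha}}$, that is, from the values $\Lambda_{\boldsymbol{\alpha}}^{(k)}(0^+)$ with $m - 1 \leq k \leq 2m-1$. That is: if $\boldsymbol{\alpha}, \boldsymbol{\alpha}' \in (0,\infty)^m$ are such that $\Lambda_{\boldsymbol{\alpha}}$ and $\Lambda_{\boldsymbol{\alpha}'}$ have the same moments of orders $1, \ldots, m$, or are such that $\Lambda_{\boldsymbol{\alpha}}^{(k)}(0^+) = \Lambda_{\boldsymbol{\alpha}'}^{(k)}(0^+)$ for $k = m-1, \ldots, 2m-1$, then $\boldsymbol{\alpha}'$ is a permutation of $\boldsymbol{\alpha}$.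
   Context: For $\boldsymbol{\alpha} = (\alpha_1, \ldots, \alpha_m) \in (0,\infty)^m$ with $m \geq 2$, $\Lambda_{\boldsymbol{\alpha}} : \mathbb{R} \to [0,\infty)$ denotes the continuous probability density function of $\alpha_1 X_1 + \cdots + \alpha_m X_m$, where $X_1, \ldots, X_m$ are independent standard exponential random variables (mean $1$). It vanishes on $(-\infty,0)$ and is smooth on $(0,\infty)$; $\Lambda_{\boldsymbol{\alpha}}^{(k)}(0^+)$ is the right-hand limit at $0$ of its $k$th derivative. The $p$th moment is $\mu_p = \int_{\mathbb{R}} x^p \Lambda_{\boldsymbol{\alpha}}(x)\,dx$. *)

theory Defs
  imports "HOL-Probability.Probability"
begin

text \<open>A parameter vector of length \<open>m\<close> is a list; two vectors agree up to permutation of their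
  entries iff their multisets of entries are equal.\<close>

definition std_exponential :: "real measure" where
  "std_exponential = density lborel (\<lambda>x. ennreal (exponential_density 1 x))"

text \<open>The independent variables \<open>X\<^sub>0, \<dots>, X\<^sub>m\<^sub>-\<^sub>1\<close> are realised as the coordinates of the product space,
  with \<open>X\<^sub>i\<close> weighted by \<open>\<alpha> ! i\<close>.\<close>

definition exponential_sample :: "nat \<Rightarrow> (nat \<Rightarrow> real) measure" where
  "exponential_sample m = Pi\<^sub>M {..<m} (\<lambda>_. std_exponential)"

definition weighted_sum :: "real list \<Rightarrow> (nat \<Rightarrow> real) \<Rightarrow> real" where
  "weighted_sum \<alpha> X = (\<Sum>i<length \<alpha>. \<alpha> ! i * X i)"

text \<open>Continuity singles out one representative of the density; it exists when \<open>\<alpha>\<close> has at least two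
  entries, all positive. Nonnegativity is needed because \<open>ennreal\<close> sends negative numbers to 0.\<close>

definition Lambda :: "real list \<Rightarrow> real \<Rightarrow> real" where
  "Lambda \<alpha> = (THE f. continuous_on UNIV f \<and> (\<forall>x. 0 \<le> f x) \<and>
     distributed (exponential_sample (length \<alpha>)) lborel (weighted_sum \<alpha>) (\<lambda>x. ennreal (f x)))"

definition Lambda_moment :: "real list \<Rightarrow> nat \<Rightarrow> real" where
  "Lambda_moment \<alpha> p = (LINT x|lborel. x ^ p * Lambda \<alpha> x)"

text \<open>The right-hand limit at 0 of the \<open>k\<close>-th derivative. Only derivatives at points \<open>x > 0\<close>, near
  which \<open>Lambda \<alpha>\<close> is smooth, enter the limit.\<close>

definition Lambda_deriv_0 :: "real list \<Rightarrow> nat \<Rightarrow> real" where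
  "Lambda_deriv_0 \<alpha> k = Lim (at_right 0) ((deriv ^^ k) (Lambda \<alpha>))"

end

(* Adding an independent variable a X to a sum with density g gives a density f with
   a f' + f = g on (0, infinity), f(0) = 0, and turns the moments mu_p / p! into their
   convolution with the powers of a. So, as formal power series,
     prod (a_i + t) * sum f^(k)(0+) t^k = t^(m-1)   and   prod (1 - a_i t) * sum mu_p t^p / p! = 1.
   The coefficients of a unit up to t^m determine those of its inverse up to t^m, hence the
   polynomial, hence its roots -a_i or 1/a_i. *)

theory Submission
  imports Defs "HOL-Computational_Algebra.Polynomial_FPS"
begin

unbundle no vec_syntax and fps_syntax

section \<open>Finitely many coefficients of an inverse series determine a product of linear
  factors\<close>

lemma fps_nth_eq_of_inverse_nth_eq:
  fixes f g h k :: "'a::comm_ring_1 fps"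
  assumes "f * h = 1" "g * k = 1" and eq: "\<And>i. i \<le> n \<Longrightarrow> h $ i = k $ i" and "i \<le> n"
  shows "f $ i = g $ i"
proof -
  \<comment> \<open>Inserting \<open>g * k = 1\<close> and \<open>f * h = 1\<close> makes the
    difference of two inverses a multiple of \<open>k - h\<close>. Its coefficient at
    \<open>i\<close> then involves \<open>k - h\<close> only up to index \<open>i\<close>, where it
    vanishes.\<close>
  have "f - g = f * (g * k) - g * (f * h)" using assms(1,2) by simp
  also have "\<dots> = (k - h) * (f * g)" by (simp add: algebra_simps)
  finally have "(f - g) $ i = ((k - h) * (f * g)) $ i" by simp
  also have "\<dots> = 0"
    unfolding fps_mult_nth using eq \<open>i \<le> n\<close> by (intro sum.neutral) auto
  finally show ?thesis by simp
qed

text \<open>The degree bound turns agreement of truncations into equality: beyond index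
  \<open>n\<close> both polynomials have zero coefficients, and up to \<open>n\<close> the truncated
  inverses decide.\<close>

lemma poly_eq_of_fps_inverse_nth_eq:
  fixes p q :: "'a::comm_ring_1 poly"
  assumes "degree p \<le> n" "degree q \<le> n"
    and "fps_of_poly p * h = 1" "fps_of_poly q * k = 1"
    and "\<And>i. i \<le> n \<Longrightarrow> h $ i = k $ i"
  shows "p = q"
proof (rule poly_eqI)
  fix i
  show "coeff p i = coeff q i"
  proof (cases "i \<le> n")
    case True
    then show ?thesis using fps_nth_eq_of_inverse_nth_eq[OF assms(3-5)] by force
  next
    case False
    then show ?thesis using assms(1,2) by (simp add: coeff_eq_0)
  qed
qed

lemma prod_fps_nth_0: "(\<Prod>i\<in>A. f i) $ 0 = (\<Prod>i\<in>A. f i $ 0 :: 'a::comm_ring_1)"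
  by (induction A rule: infinite_finite_induct) auto

lemma mset_conv_image_nth: "mset xs = image_mset ((!) xs) (mset_set {..<length xs})"
  by (metis atLeast0LessThan map_nth mset_map mset_set_upto_eq_mset_upto)

lemma proots_prod_linear:
  fixes xs :: "real list"
  shows "proots (\<Prod>i<length xs. [:xs ! i, 1:]) = image_mset uminus (mset xs)"
proof -
  have "proots (\<Prod>i<length xs. [:xs ! i, 1:]) = (\<Sum>i<length xs. {#- (xs ! i)#})"
    by (subst proots_prod) auto
  also have "\<dots> = image_mset (\<lambda>i. - (xs ! i)) (mset_set {..<length xs})"
    by (simp add: sum_unfold_sum_mset)
  finally show ?thesis by (simp add: mset_conv_image_nth[of xs] image_mset.compositionality comp_def)
qed

text \<open>Zero entries must be excluded: such an entry would contribute the rootless factor 1 on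
  the left, but \<open>inverse 0 = 0\<close> on the right.\<close>

lemma proots_prod_reversed_linear:
  fixes xs :: "real list"
  assumes "0 \<notin> set xs"
  shows "proots (\<Prod>i<length xs. [:1, - xs ! i:]) = image_mset inverse (mset xs)"
proof -
  have "proots [:1, - xs ! i:] = {#inverse (xs ! i)#}" if "i < length xs" for i
  proof -
    have nz: "xs ! i \<noteq> 0" using assms that nth_mem by metis
    \<comment> \<open>Extracting the nonzero leading coefficient leaves a monic factor with visible
      root, and a nonzero scalar does not affect the roots.\<close>
    then have "[:1, - xs ! i:] = smult (- xs ! i) [:- inverse (xs ! i), 1:]" by simp
    then show ?thesis using nz using proots_smult[of "- xs ! i" "[:- inverse (xs ! i), 1:]"]
      by (simp del: proots_smult)
  qed
  then have "proots (\<Prod>i<length xs. [:1, - xs ! i:]) = (\<Sum>i<length xs. {#inverse (xs ! i)#})"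
    by (subst proots_prod) auto
  also have "\<dots> = image_mset (\<lambda>i. inverse (xs ! i)) (mset_set {..<length xs})"
    by (simp add: sum_unfold_sum_mset)
  finally show ?thesis by (simp add: mset_conv_image_nth[of xs] image_mset.compositionality comp_def)
qed

lemma degree_prod_linear_le:
  fixes f :: "nat \<Rightarrow> 'a::comm_ring_1 poly"
  assumes "\<And>i. i < n \<Longrightarrow> degree (f i) \<le> 1"
  shows "degree (\<Prod>i<n. f i) \<le> n"
proof -
  have "degree (\<Prod>i<n. f i) \<le> (\<Sum>i<n. degree (f i))"
    using degree_prod_sum_le[of "{..<n}" f] by (simp add: comp_def)
  also have "\<dots> \<le> (\<Sum>i<n. 1)" by (intro sum_mono) (use assms in auto)
  finally show ?thesis by simp
qed

lemma mset_eq_of_fps_inverse: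
  fixes xs ys :: "real list"
  assumes len: "length xs = n" "length ys = n"
    and "(\<Prod>i<n. fps_of_poly [:xs ! i, 1:]) * h = 1" "(\<Prod>i<n. fps_of_poly [:ys ! i, 1:]) * k = 1"
    and "\<And>i. i \<le> n \<Longrightarrow> h $ i = k $ i"
  shows "mset xs = mset ys"
proof -
  have "(\<Prod>i<n. [:xs ! i, 1:]) = (\<Prod>i<n. [:ys ! i, 1:])"
    by (rule poly_eq_of_fps_inverse_nth_eq[where n = n and h = h and k = k])
       (use assms in \<open>auto intro!: degree_prod_linear_le simp: fps_of_poly_prod\<close>)
  then have "image_mset uminus (mset xs) = image_mset uminus (mset ys)"
    using proots_prod_linear[of xs] proots_prod_linear[of ys] len by simp
  then have "image_mset uminus (image_mset uminus (mset xs)) = image_mset uminus (image_mset uminus (mset ys))" by simp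
  then show ?thesis by (simp add: image_mset.compositionality comp_def)
qed

lemma mset_eq_of_reversed_fps_inverse:
  fixes xs ys :: "real list"
  assumes len: "length xs = n" "length ys = n" and nz: "0 \<notin> set xs" "0 \<notin> set ys"
    and "(\<Prod>i<n. fps_of_poly [:1, - xs ! i:]) * h = 1" "(\<Prod>i<n. fps_of_poly [:1, - ys ! i:]) * k = 1"
    and "\<And>i. i \<le> n \<Longrightarrow> h $ i = k $ i"
  shows "mset xs = mset ys"
proof -
  have "(\<Prod>i<n. [:1, - xs ! i:]) = (\<Prod>i<n. [:1, - ys ! i:])"
    by (rule poly_eq_of_fps_inverse_nth_eq[where n = n and h = h and k = k])
       (use assms in \<open>auto intro!: degree_prod_linear_le simp: fps_of_poly_prod\<close>)
  then have "image_mset inverse (mset xs) = image_mset inverse (mset ys)"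
    using proots_prod_reversed_linear[of xs] proots_prod_reversed_linear[of ys] len nz by simp
  \<comment> \<open>Inversion is an involution, so applying it once more recovers the entries with
    their multiplicities.\<close>
  then have "image_mset inverse (image_mset inverse (mset xs)) = image_mset inverse (image_mset inverse (mset ys))" by simp
  then show ?thesis by (simp add: image_mset.compositionality comp_def)
qed

section \<open>Functions smooth on the whole line with all their derivatives, and the equation a f'
  + f = g\<close>

definition derivative_chain :: "(nat \<Rightarrow> real \<Rightarrow> real) \<Rightarrow> bool" where
  "derivative_chain D \<longleftrightarrow> (\<forall>k x. (D k has_real_derivative D (Suc k) x) (at x))"

lemma derivative_chain_isCont: "derivative_chain D \<Longrightarrow> isCont (D k) x"
  unfolding derivative_chain_def using DERIV_isCont by blast

lemma derivative_chain_continuous_on: "derivative_chain D \<Longrightarrow> continuous_on A (D k)"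
  by (simp add: continuous_at_imp_continuous_on derivative_chain_isCont)

text \<open>Derivatives at a point of an open set depend only on the values there. This lets a
  density that is cut off to 0 on the negative axis be compared with a function smooth across
  0.\<close>

lemma derivative_chain_deriv:
  assumes D: "derivative_chain D" and "open U" and "\<And>x. x \<in> U \<Longrightarrow> f x = D 0 x" and "x \<in> U"
  shows "(deriv ^^ k) f x = D k x"
  using \<open>x \<in> U\<close>
proof (induction k arbitrary: x)
  case 0
  then show ?case using assms by simp
next
  case (Suc k)
  have "((deriv ^^ k) f has_real_derivative D (Suc k) x) (at x)"
  proof (rule has_field_derivative_transform_within_open[OF _ \<open>open U\<close> Suc.prems])
    show "(D k has_real_derivative D (Suc k) x) (at x)"
      using D by (simp add: derivative_chain_def)
  qed (simp add: Suc.IH)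
  then show ?case by (simp add: DERIV_imp_deriv)
qed

lemma first_order_ode_chain:
  assumes g: "derivative_chain g" and a: "a \<noteq> 0"
  obtains f where "derivative_chain f" "f 0 0 = 0" "\<And>k x. a * f (Suc k) x + f k x = g k x"
proof -
  \<comment> \<open>Integrating factor: multiplying the equation by \<open>exp (x / a) / a\<close>
    turns its left side into the derivative of \<open>exp (x / a) * f 0 x\<close>, and
    \<open>h\<close> is the resulting right side.\<close>
  define h where "h = (\<lambda>x. exp (x / a) * g 0 x / a)"
  have "\<exists>H. \<forall>x::real. -\<infinity> < ereal x \<longrightarrow> ereal x < \<infinity> \<longrightarrow> (H has_vector_derivative h x) (at x)"
    by (rule einterval_antiderivative)
       (auto simp: h_def a intro!: continuous_intros derivative_chain_isCont[OF g])
  then obtain H where H: "\<And>x. (H has_real_derivative h x) (at x)"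
    by (auto simp: has_real_derivative_iff_has_vector_derivative)
  \<comment> \<open>Subtracting \<open>H 0\<close> enforces the initial value. The higher entries
    solve the recurrence for its top term, so the recurrence holds by construction and it remains to
    show that each entry is the derivative of the one before.\<close>
  define f where "f = rec_nat (\<lambda>x. exp (- x / a) * (H x - H 0)) (\<lambda>k fk x. (g k x - fk x) / a)"
  have f0: "f 0 = (\<lambda>x. exp (- x / a) * (H x - H 0))"
    and fS: "\<And>k. f (Suc k) = (\<lambda>x. (g k x - f k x) / a)"
    by (simp_all add: f_def)
  have "(f k has_real_derivative f (Suc k) x) (at x)" for k x
  proof (induction k)
    case 0
    have "exp (- (x / a)) * exp (x / a) = 1" by (simp flip: exp_add)
    then have "(f 0 has_real_derivative (g 0 x - f 0 x) / a) (at x)"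
      unfolding f0 by (auto intro!: derivative_eq_intros H simp: a h_def field_simps)
    then show ?case by (simp add: fS)
  next
    case (Suc k)
    have "(g k has_real_derivative g (Suc k) x) (at x)" using g by (simp add: derivative_chain_def)
    then show ?case unfolding fS[of "Suc k"] fS[of k]
      using Suc[unfolded fS[of k]] a by (auto intro!: derivative_eq_intros simp: fS)
  qed
  then have "derivative_chain f" by (simp add: derivative_chain_def)
  then show ?thesis using that[of f] a by (simp add: f0 fS)
qed

section \<open>Uniqueness of the continuous density\<close>

lemma continuous_AE_lborel_imp_eq:
  fixes f g :: "real \<Rightarrow> 'a::t2_space"
  assumes "continuous_on UNIV f" "continuous_on UNIV g" "AE x in lborel. f x = g x"
  shows "f = g"
proof -
  \<comment> \<open>The set of disagreement is open, by continuity into a Hausdorff space, and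
    negligible; a nonempty open set cannot be negligible.\<close>
  have "open {x. f x \<noteq> g x}"
    using open_Collect_neq[OF assms(1,2)] .
  moreover have "AE x in lebesgue. f x = g x" using assms(3) by (rule AE_completion)
  then have "negligible {x. f x \<noteq> g x}"
    by (simp add: AE_iff_null_sets negligible_iff_null_sets completion.AE_iff_null_sets)
  ultimately have "{x. f x \<noteq> g x} = {}" using open_not_negligible by blast
  then show ?thesis by auto
qed

lemma Lambda_eqI:
  assumes P: "prob_space (exponential_sample (length \<alpha>))"
    and "continuous_on UNIV f" "\<And>x. 0 \<le> f x"
    and "distributed (exponential_sample (length \<alpha>)) lborel (weighted_sum \<alpha>) (\<lambda>x. ennreal (f x))"
  shows "Lambda \<alpha> = f"
  unfolding Lambda_def
proof (rule the_equality)
  fix g assume g: "continuous_on UNIV g \<and> (\<forall>x. 0 \<le> g x) \<and>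
     distributed (exponential_sample (length \<alpha>)) lborel (weighted_sum \<alpha>) (\<lambda>x. ennreal (g x))"
  then have "AE x in lborel. ennreal (g x) = ennreal (f x)"
    using prob_space.distributed_unique[OF P _ assms(4)] by blast
  \<comment> \<open>Both functions are nonnegative, and \<open>ennreal\<close> is injective on such
    values.\<close>
  then have "AE x in lborel. g x = f x" using g assms(3) by simp
  then show "g = f" using g assms(2) continuous_AE_lborel_imp_eq by blast
qed (use assms in auto)

section \<open>Density of a sum of independent exponentials\<close>

lemma (in prob_space) sum_exponential_density_step:
  assumes ind: "indep_var borel X borel Y" and a: "a > 0"
    and X: "distributed M lborel X (exponential_density (1 / a))"
    and Y: "distributed M lborel Y (\<lambda>x. ennreal (if x < 0 then 0 else g 0 x))"
    and g: "derivative_chain g" "\<And>x. x \<ge> 0 \<Longrightarrow> g 0 x \<ge> 0"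
    and f: "derivative_chain f" "f 0 0 = 0" "\<And>k x. a * f (Suc k) x + f k x = g k x"
  shows "distributed M lborel (\<lambda>\<omega>. X \<omega> + Y \<omega>) (\<lambda>x. ennreal (if x < 0 then 0 else f 0 x))"
    and "\<And>x. x \<ge> 0 \<Longrightarrow> f 0 x \<ge> 0"
proof -
  \<comment> \<open>For fixed \<open>x\<close> this is an antiderivative of the convolution
    integrand. It is 0 at \<open>y = 0\<close> and \<open>f 0 x\<close> at \<open>y = x\<close>, so
    it gives both nonnegativity (by monotonicity) and the value of the convolution.\<close>
  have deriv: "((\<lambda>y. exp (- (x - y) / a) * f 0 y) has_real_derivative
      exp (- (x - y) / a) / a * g 0 y) (at y)" for x y
  proof -
    have "(f 0 has_real_derivative f (Suc 0) y) (at y)" using f(1) by (simp add: derivative_chain_def)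
    moreover have "g 0 y = a * f (Suc 0) y + f 0 y" using f(3) by simp
    ultimately show ?thesis using a
      by (auto intro!: derivative_eq_intros simp: field_simps)
  qed
  have [measurable]: "g 0 \<in> borel_measurable borel"
    using derivative_chain_continuous_on[OF g(1)] by (rule borel_measurable_continuous_onI)
  show nonneg: "f 0 x \<ge> 0" if "x \<ge> 0" for x
    using DERIV_nonneg_imp_nondecreasing[OF that, of "\<lambda>y. exp (- (x - y) / a) * f 0 y"]
      deriv[of x] g(2) a f(2) by fastforce
  have "(\<integral>\<^sup>+y. ennreal (exponential_density (1 / a) (x - y)) * ennreal (if y < 0 then 0 else g 0 y) \<partial>lborel)
      = ennreal (if x < 0 then 0 else f 0 x)" for x
  proof -
    have "(\<integral>\<^sup>+y. ennreal (exponential_density (1 / a) (x - y)) * ennreal (if y < 0 then 0 else g 0 y) \<partial>lborel)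
      = (\<integral>\<^sup>+y. ennreal (exp (- (x - y) / a) / a * g 0 y) * indicator {0..x} y \<partial>lborel)"
      using a g(2)
      by (intro nn_integral_cong)
         (auto simp: exponential_density_def ennreal_mult'[symmetric] split: split_indicator)
    also have "\<dots> = ennreal (if x < 0 then 0 else f 0 x)"
    proof (cases "x < 0")
      case False
      then show ?thesis
        using a g(2) f(2) deriv[of x]
        by (subst nn_integral_FTC_Icc[where F = "\<lambda>y. exp (- (x - y) / a) * f 0 y"]) auto
    qed auto
    finally show ?thesis .
  qed
  then show "distributed M lborel (\<lambda>\<omega>. X \<omega> + Y \<omega>) (\<lambda>x. ennreal (if x < 0 then 0 else f 0 x))"
    using distributed_convolution[OF ind X Y] by simp
qed

text \<open>Coefficient \<open>n\<close> of (a + X) F is a F_n + F_(n-1), which is G_(n-1) for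
  positive \<open>n\<close>; the initial condition covers \<open>n = 0\<close>. Thus each
  convolution costs one factor \<open>fps_X\<close>.\<close>

lemma fps_first_order_recurrence:
  fixes F G :: "real fps"
  assumes "\<And>k. a * F $ Suc k + F $ k = G $ k" "F $ 0 = 0"
  shows "fps_of_poly [:a, 1:] * F = fps_X * G"
proof (rule fps_ext)
  fix n
  show "(fps_of_poly [:a, 1:] * F) $ n = (fps_X * G) $ n"
    using assms(2) assms(1)[of "n - 1"] by (cases n) (auto simp: fps_of_poly_linear algebra_simps)
qed

text \<open>The index set \<open>{..n}\<close> has \<open>n + 1\<close> elements: an empty sum has
  no density, so the induction starts with one variable. The series collects the derivatives at 0
  themselves, without factorials, so that the differential equation becomes multiplication by a
  linear factor.\<close>

lemma (in prob_space) sum_exponential_density: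
  fixes X :: "nat \<Rightarrow> 'a \<Rightarrow> real"
  assumes "indep_vars (\<lambda>_. borel) X {..n}" and "\<And>i. i \<le> n \<Longrightarrow> a i > 0"
    and "\<And>i. i \<le> n \<Longrightarrow> distributed M lborel (X i) (exponential_density (1 / a i))"
  obtains f where "derivative_chain f" "\<And>x. x \<ge> 0 \<Longrightarrow> f 0 x \<ge> 0"
    "distributed M lborel (\<lambda>\<omega>. \<Sum>i\<le>n. X i \<omega>) (\<lambda>x. ennreal (if x < 0 then 0 else f 0 x))"
    "(\<Prod>i\<le>n. fps_of_poly [:a i, 1:]) * Abs_fps (\<lambda>k. f k 0) = fps_X ^ n"
  using assms
proof (induction n arbitrary: thesis)
  case 0
  have a: "a 0 > 0" using 0(3) by simp
  \<comment> \<open>These are the successive derivatives of exp(-x/a)/a. Their values at 0 form a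
    geometric sequence whose series is 1/(a + X).\<close>
  define f where "f = (\<lambda>k x. (- 1 / a 0) ^ k * (exp (- x / a 0) / a 0))"
  have chain: "derivative_chain f"
    unfolding derivative_chain_def f_def using a by (auto intro!: derivative_eq_intros)
  have "exponential_density (1 / a 0) = (\<lambda>x. if x < 0 then 0 else f 0 x)"
    by (auto simp: exponential_density_def f_def)
  then have "distributed M lborel (\<lambda>\<omega>. \<Sum>i\<le>0. X i \<omega>) (\<lambda>x. ennreal (if x < 0 then 0 else f 0 x))"
    using 0(4)[of 0] by simp
  moreover have "(\<Prod>i\<le>0. fps_of_poly [:a i, 1:]) * Abs_fps (\<lambda>k. f k 0) = fps_X ^ 0"
  proof (rule fps_ext)
    fix k
    show "((\<Prod>i\<le>0. fps_of_poly [:a i, 1:]) * Abs_fps (\<lambda>k. f k 0)) $ k = (fps_X ^ 0) $ k"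
      using a by (cases k) (auto simp: fps_of_poly_linear algebra_simps f_def)
  qed
  ultimately show ?case using a by (intro 0(1)[OF chain]) (auto simp: f_def)
next
  case (Suc n)
  have "indep_vars (\<lambda>_. borel) X {..n}"
    using indep_vars_subset[OF Suc.prems(2)] by auto
  note IH = Suc.IH[OF _ this Suc.prems(3)[OF le_SucI] Suc.prems(4)[OF le_SucI]]
  obtain g where g: "derivative_chain g" "\<And>x. x \<ge> 0 \<Longrightarrow> g 0 x \<ge> 0"
    "distributed M lborel (\<lambda>\<omega>. \<Sum>i\<le>n. X i \<omega>) (\<lambda>x. ennreal (if x < 0 then 0 else g 0 x))"
    "(\<Prod>i\<le>n. fps_of_poly [:a i, 1:]) * Abs_fps (\<lambda>k. g k 0) = fps_X ^ n"
    using IH by blast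
  have a: "a (Suc n) > 0" using Suc.prems by simp
  obtain f where f: "derivative_chain f" "f 0 0 = 0" "\<And>k x. a (Suc n) * f (Suc k) x + f k x = g k x"
    using first_order_ode_chain[OF g(1), of "a (Suc n)"] a by auto
  have "indep_var borel (X (Suc n)) borel (\<lambda>\<omega>. \<Sum>i\<le>n. X i \<omega>)"
    using Suc.prems(2) by (intro indep_vars_sum) (auto simp: atMost_Suc)
  note step = sum_exponential_density_step[where f = f and g = g and a = "a (Suc n)",
      OF this a Suc.prems(4)[OF order_refl] g(3,1,2) f]
  have rec: "fps_of_poly [:a (Suc n), 1:] * Abs_fps (\<lambda>k. f k 0) = fps_X * Abs_fps (\<lambda>k. g k 0)"
    by (rule fps_first_order_recurrence) (use f in auto)
  have "(\<Prod>i\<le>Suc n. fps_of_poly [:a i, 1:]) * Abs_fps (\<lambda>k. f k 0)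
      = (\<Prod>i\<le>n. fps_of_poly [:a i, 1:]) * (fps_of_poly [:a (Suc n), 1:] * Abs_fps (\<lambda>k. f k 0))"
    by (simp add: mult_ac)
  also have "\<dots> = fps_X * ((\<Prod>i\<le>n. fps_of_poly [:a i, 1:]) * Abs_fps (\<lambda>k. g k 0))"
    unfolding rec by (simp add: mult_ac)
  finally have "(\<Prod>i\<le>Suc n. fps_of_poly [:a i, 1:]) * Abs_fps (\<lambda>k. f k 0) = fps_X ^ Suc n"
    by (simp add: g(4))
  with step show ?case by (intro Suc.prems(1)[OF f(1)]) (auto simp: add.commute)
qed

section \<open>Moments of a sum of independent exponentials\<close>

lemma (in prob_space) exponential_power_sum:
  assumes ind: "indep_var borel X borel Y" and a: "a > 0"
    and X: "distributed M lborel X (exponential_density (1 / a))"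
    and Y: "\<And>p. integrable M (\<lambda>\<omega>. Y \<omega> ^ p)"
  shows "integrable M (\<lambda>\<omega>. (X \<omega> + Y \<omega>) ^ p)"
    and "expectation (\<lambda>\<omega>. (X \<omega> + Y \<omega>) ^ p) / fact p
      = (\<Sum>k\<le>p. a ^ k * (expectation (\<lambda>\<omega>. Y \<omega> ^ (p - k)) / fact (p - k)))"
proof -
  have l: "1 / a > 0" using a by simp
  have indk: "indep_var borel (\<lambda>\<omega>. X \<omega> ^ k) borel (\<lambda>\<omega>. Y \<omega> ^ j)" for k j
    using indep_var_compose[OF ind, of "\<lambda>x. x ^ k" borel "\<lambda>x. x ^ j" borel] by (simp add: comp_def)
  have Xi: "integrable M (\<lambda>\<omega>. X \<omega> ^ k)" for k
    by (rule erlang_ith_moment_integrable[OF l X])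
  have XY: "integrable M (\<lambda>\<omega>. X \<omega> ^ k * Y \<omega> ^ j)"
    "expectation (\<lambda>\<omega>. X \<omega> ^ k * Y \<omega> ^ j) = (fact k * a ^ k) * expectation (\<lambda>\<omega>. Y \<omega> ^ j)" for k j
    using indep_var_integrable[OF indk Xi Y] indep_var_lebesgue_integral[OF indk Xi Y]
      erlang_ith_moment[OF l X, of k] by (simp_all add: power_one_over)
  show "integrable M (\<lambda>\<omega>. (X \<omega> + Y \<omega>) ^ p)"
    unfolding binomial_ring using XY(1) by (auto simp: mult.assoc)
  have "expectation (\<lambda>\<omega>. (X \<omega> + Y \<omega>) ^ p)
      = (\<Sum>k\<le>p. of_nat (p choose k) * (fact k * a ^ k * expectation (\<lambda>\<omega>. Y \<omega> ^ (p - k))))"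
    unfolding binomial_ring using XY by (simp add: mult.assoc)
  \<comment> \<open>The factor \<open>fact k\<close> from the \<open>k\<close>th exponential moment
    cancels the one in the binomial coefficient, so division by \<open>fact p\<close> leaves a
    Cauchy product with the powers of \<open>a\<close>.\<close>
  also have "\<dots> / fact p = (\<Sum>k\<le>p. a ^ k * (expectation (\<lambda>\<omega>. Y \<omega> ^ (p - k)) / fact (p - k)))"
    unfolding sum_divide_distrib by (intro sum.cong) (auto simp: binomial_fact)
  finally show "expectation (\<lambda>\<omega>. (X \<omega> + Y \<omega>) ^ p) / fact p
      = (\<Sum>k\<le>p. a ^ k * (expectation (\<lambda>\<omega>. Y \<omega> ^ (p - k)) / fact (p - k)))" .
qed

lemma geometric_fps: "fps_of_poly [:1, - a:] * Abs_fps (\<lambda>k. a ^ k) = (1 :: real fps)"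
proof (rule fps_ext)
  fix n
  show "(fps_of_poly [:1, - a:] * Abs_fps (\<lambda>k. a ^ k)) $ n = (1 :: real fps) $ n"
    unfolding fps_of_poly_linear' by (cases n) (auto simp: algebra_simps)
qed

text \<open>Moments, unlike densities, make sense for the empty sum, whose series is 1. Each new
  variable multiplies the series by a geometric one, inverse to its linear factor. Integrability is
  carried along because the next expansion relies on it.\<close>

lemma (in prob_space) sum_exponential_moments:
  fixes X :: "nat \<Rightarrow> 'a \<Rightarrow> real"
  assumes "indep_vars (\<lambda>_. borel) X {..<n}" and "\<And>i. i < n \<Longrightarrow> a i > 0"
    and "\<And>i. i < n \<Longrightarrow> distributed M lborel (X i) (exponential_density (1 / a i))"
  shows "(\<forall>p. integrable M (\<lambda>\<omega>. (\<Sum>i<n. X i \<omega>) ^ p)) \<and>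
    (\<Prod>i<n. fps_of_poly [:1, - a i:]) * Abs_fps (\<lambda>p. expectation (\<lambda>\<omega>. (\<Sum>i<n. X i \<omega>) ^ p) / fact p) = 1"
  using assms
proof (induction n)
  case 0
  have "Abs_fps (\<lambda>p. expectation (\<lambda>\<omega>. 0 ^ p) / fact p) = (1 :: real fps)"
    by (rule fps_ext) (auto simp: power_0_left prob_space)
  then show ?case by simp
next
  case (Suc n)
  define Q where "Q = (\<Prod>i<n. fps_of_poly [:1, - a i:])"
  define F where "F n = Abs_fps (\<lambda>p. expectation (\<lambda>\<omega>. (\<Sum>i<n. X i \<omega>) ^ p) / fact p)" for n
  have IH: "\<And>p. integrable M (\<lambda>\<omega>. (\<Sum>i<n. X i \<omega>) ^ p)" "Q * F n = 1"
    using Suc.IH Suc.prems indep_vars_subset[OF Suc.prems(1), of "{..<n}"] by (auto simp: Q_def F_def)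
  have ind: "indep_var borel (X n) borel (\<lambda>\<omega>. \<Sum>i<n. X i \<omega>)"
    using Suc.prems(1) by (intro indep_vars_sum) (auto simp: lessThan_Suc)
  note step = exponential_power_sum[OF ind Suc.prems(2)[of n] Suc.prems(3)[of n] IH(1), simplified]
  have "F (Suc n) = Abs_fps (\<lambda>k. a n ^ k) * F n"
    by (rule fps_ext) (simp add: F_def fps_mult_nth add.commute[of "sum _ _"] step(2) atLeast0AtMost)
  then have "(Q * fps_of_poly [:1, - a n:]) * F (Suc n)
      = (Q * F n) * (fps_of_poly [:1, - a n:] * Abs_fps (\<lambda>k. a n ^ k))"
    by (simp add: mult_ac)
  then have "(Q * fps_of_poly [:1, - a n:]) * F (Suc n) = 1"
    using IH(2) geometric_fps by simp
  then show ?case using step(1) by (simp add: Q_def F_def add.commute)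
qed

section \<open>Laws and independence of the scaled coordinates\<close>

lemma prob_space_std_exponential: "prob_space std_exponential"
  unfolding std_exponential_def by (rule prob_space_erlang_density) simp

lemma prob_space_exponential_sample: "prob_space (exponential_sample m)"
  unfolding exponential_sample_def by (intro prob_space_PiM prob_space_std_exponential)

lemma sets_std_exponential [measurable_cong]: "sets std_exponential = sets borel"
  by (simp add: std_exponential_def)

lemma exponential_sample_component:
  assumes "i < m" and c: "c > 0"
  shows "distributed (exponential_sample m) lborel (\<lambda>\<omega>. c * \<omega> i) (exponential_density (1 / c))"
proof -
  interpret prob_space "exponential_sample m" by (rule prob_space_exponential_sample)
  have meas: "(\<lambda>\<omega>. \<omega> i) \<in> borel_measurable (exponential_sample m)"
    using \<open>i < m\<close> measurable_component_singleton[of i "{..<m}" "\<lambda>_. std_exponential"]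
    unfolding exponential_sample_def by (simp cong: measurable_cong_sets add: sets_std_exponential)
  have "distr (exponential_sample m) lborel (\<lambda>\<omega>. \<omega> i)
      = distr (exponential_sample m) std_exponential (\<lambda>\<omega>. \<omega> i)"
    by (rule distr_cong) (auto simp: sets_std_exponential)
  also have "\<dots> = std_exponential"
    unfolding exponential_sample_def
    using \<open>i < m\<close> prob_space_std_exponential by (intro distr_PiM_component) auto
  finally have "distributed (exponential_sample m) lborel (\<lambda>\<omega>. \<omega> i) (exponential_density 1)"
    using meas by (simp add: distributed_def std_exponential_def)
  \<comment> \<open>Scaling by \<open>c\<close> changes the mean from 1 to \<open>c\<close>, hence
    the rate to \<open>1 / c\<close>.\<close>
  from distributed_affine[OF this, of c 0] c
  have "distributed (exponential_sample m) lborel (\<lambda>\<omega>. c * \<omega> i)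
     (\<lambda>x. ennreal (exponential_density 1 (x / c)) / ennreal c)"
    by simp
  also have "(\<lambda>x. ennreal (exponential_density 1 (x / c)) / ennreal c) = exponential_density (1 / c)"
    using c by (auto simp: exponential_density_def divide_ennreal field_simps)
  finally show ?thesis .
qed

lemma exponential_sample_indep:
  assumes "m > 0"
  shows "prob_space.indep_vars (exponential_sample m) (\<lambda>_. borel) (\<lambda>i \<omega>. c i * \<omega> i) {..<m}"
proof -
  interpret prob_space "exponential_sample m" by (rule prob_space_exponential_sample)
  have "indep_vars (\<lambda>_. std_exponential) (\<lambda>i \<omega>. \<omega> i) {..<m}"
  proof (subst indep_vars_iff_distr_eq_PiM')
    show "distr (exponential_sample m) (Pi\<^sub>M {..<m} (\<lambda>_. std_exponential)) (\<lambda>x. \<lambda>i\<in>{..<m}. x i)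
      = Pi\<^sub>M {..<m} (\<lambda>i. distr (exponential_sample m) std_exponential (\<lambda>\<omega>. \<omega> i))"
    proof -
      \<comment> \<open>Points of the product space are extensional, so restricting them to the
        index set is the identity; the joint law is then the product measure itself.\<close>
      have "distr (exponential_sample m) (Pi\<^sub>M {..<m} (\<lambda>_. std_exponential)) (\<lambda>x. \<lambda>i\<in>{..<m}. x i)
        = distr (exponential_sample m) (exponential_sample m) (\<lambda>x. x)"
        unfolding exponential_sample_def
        by (intro distr_cong) (auto simp: space_PiM PiE_def extensional_restrict)
      also have "\<dots> = Pi\<^sub>M {..<m} (\<lambda>_. std_exponential)"
        by (simp add: exponential_sample_def)
      also have "\<dots> = Pi\<^sub>M {..<m} (\<lambda>i. distr (exponential_sample m) std_exponential (\<lambda>\<omega>. \<omega> i))"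
        unfolding exponential_sample_def using prob_space_std_exponential
        by (intro PiM_cong) (auto intro!: distr_PiM_component[symmetric])
      finally show ?thesis .
    qed
  qed (use assms in \<open>auto simp: exponential_sample_def\<close>)
  then show ?thesis
    by (rule indep_vars_compose2) measurable
qed

section \<open>The two generating series of \<open>Lambda\<close>\<close>

lemma Lambda_generating_fps:
  assumes "length \<alpha> \<ge> 2" and pos: "\<forall>a\<in>set \<alpha>. a > 0"
  obtains f where "derivative_chain f" "Lambda \<alpha> = (\<lambda>x. if x < 0 then 0 else f 0 x)"
    "(\<Prod>i<length \<alpha>. fps_of_poly [:\<alpha> ! i, 1:]) * Abs_fps (\<lambda>k. f k 0) = fps_X ^ (length \<alpha> - 1)"
    "(\<Prod>i<length \<alpha>. fps_of_poly [:1, - \<alpha> ! i:]) * Abs_fps (\<lambda>p. Lambda_moment \<alpha> p / fact p) = 1"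
proof -
  define m where "m = length \<alpha>"
  interpret prob_space "exponential_sample m" by (rule prob_space_exponential_sample)
  have m: "{..m - 1} = {..<m}" "m \<ge> 2" using assms by (auto simp: m_def)
  have a: "\<alpha> ! i > 0" if "i < m" for i using pos that by (simp add: m_def)
  define X where "X = (\<lambda>i \<omega>. \<alpha> ! i * (\<omega> i :: real))"
  have W: "weighted_sum \<alpha> = (\<lambda>\<omega>. \<Sum>i<m. X i \<omega>)"
    by (simp add: fun_eq_iff weighted_sum_def m_def X_def)
  have ind: "indep_vars (\<lambda>_. borel) X {..<m}"
    unfolding X_def using m(2) by (intro exponential_sample_indep) simp
  have D: "distributed (exponential_sample m) lborel (X i) (exponential_density (1 / \<alpha> ! i))" if "i < m" for i
    unfolding X_def using exponential_sample_component a that by blast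
  have lt: "i \<le> m - 1 \<longleftrightarrow> i < m" for i using m by auto
  obtain f where f: "derivative_chain f" "\<And>x. x \<ge> 0 \<Longrightarrow> f 0 x \<ge> 0"
    "distributed (exponential_sample m) lborel (weighted_sum \<alpha>) (\<lambda>x. ennreal (if x < 0 then 0 else f 0 x))"
    "(\<Prod>i<m. fps_of_poly [:\<alpha> ! i, 1:]) * Abs_fps (\<lambda>k. f k 0) = fps_X ^ (m - 1)"
    using sum_exponential_density[of X "m - 1" "\<lambda>i. \<alpha> ! i"] ind a D unfolding lt m(1) W by blast
  \<comment> \<open>Comparing constant terms: as \<open>m\<close> is at least 2, the right side has
    none, so the smooth function vanishes at 0. This is what makes its cut-off continuous.\<close>
  have "(\<Prod>i<m. \<alpha> ! i) * f 0 0 = 0"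
    using arg_cong[OF f(4), of "\<lambda>F. F $ 0"] m(2) by (simp add: prod_fps_nth_0)
  then have f00: "f 0 0 = 0" using a by (force simp: prod_zero_iff)
  have "{..0} \<union> {0..} = (UNIV :: real set)" by auto
  \<comment> \<open>Gluing is done over two closed half-lines that overlap at 0; since the value
    there is 0, the strict and weak case distinctions agree.\<close>
  then have "continuous_on UNIV (\<lambda>x. if x \<le> 0 then 0 else f 0 x)"
    using continuous_on_If[of "{..0}" "{0..}" "\<lambda>_. 0" "f 0" "\<lambda>x. x \<le> 0"] f00
      derivative_chain_continuous_on[OF f(1)] by auto
  also have "(\<lambda>x. if x \<le> 0 then 0 else f 0 x) = (\<lambda>x. if x < 0 then 0 else f 0 x)"
    using f00 by auto
  finally have cont: "continuous_on UNIV (\<lambda>x. if x < 0 then 0 else f 0 x)" .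
  have L: "Lambda \<alpha> = (\<lambda>x. if x < 0 then 0 else f 0 x)"
    using prob_space_exponential_sample cont f(2,3) by (intro Lambda_eqI) (auto simp: m_def)
  have "Lambda_moment \<alpha> p = expectation (\<lambda>\<omega>. (\<Sum>i<m. X i \<omega>) ^ p)" for p
  proof -
    have "(LINT x|lborel. Lambda \<alpha> x * x ^ p) = expectation (\<lambda>\<omega>. weighted_sum \<alpha> \<omega> ^ p)"
      by (rule distributed_integral) (use f(2,3) L in auto)
    then show ?thesis by (simp add: Lambda_moment_def W mult.commute)
  qed
  then show ?thesis
    using that[OF f(1) L] f(4) sum_exponential_moments[of X m "\<lambda>i. \<alpha> ! i"] ind a D by (simp add: m_def)
qed

text \<open>The right-hand limit sees only positive points, where \<open>Lambda\<close> coincides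
  with the smooth function, and the derivatives of the latter are continuous at 0.\<close>

lemma Lambda_deriv_0_eq:
  assumes f: "derivative_chain f" and L: "Lambda \<alpha> = (\<lambda>x. if x < 0 then 0 else f 0 x)"
  shows "Lambda_deriv_0 \<alpha> k = f k 0"
proof -
  have "(deriv ^^ k) (Lambda \<alpha>) x = f k x" if "x > 0" for x
    by (rule derivative_chain_deriv[OF f, of "{0<..}"]) (use L that in auto)
  then have "eventually (\<lambda>x. f k x = (deriv ^^ k) (Lambda \<alpha>) x) (at_right 0)"
    by (auto simp: eventually_at_filter)
  moreover have "(f k \<longlongrightarrow> f k 0) (at_right 0)"
    using derivative_chain_isCont[OF f, where k = k and x = 0] by (simp add: isCont_def filterlim_at_split)
  ultimately have "((deriv ^^ k) (Lambda \<alpha>) \<longlongrightarrow> f k 0) (at_right 0)"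
    using tendsto_cong by blast
  then show ?thesis unfolding Lambda_deriv_0_def by (intro tendsto_Lim) auto
qed

section \<open>Recovery of the parameters\<close>

lemma fps_shift_mult_eq_1:
  fixes P F :: "real fps"
  assumes "P * F = fps_X ^ n" and "P $ 0 \<noteq> 0"
  shows "P * fps_shift n F = 1"
proof -
  have inv: "inverse P * P = 1" using assms(2) by (rule inverse_mult_eq_1)
  \<comment> \<open>\<open>P\<close> is a unit, so \<open>F\<close> is its inverse delayed by
    \<open>n\<close> places, and the shift undoes the delay.\<close>
  have "F = inverse P * fps_X ^ n" using assms(1) inv by (metis mult.assoc mult_1)
  then have "fps_shift n F = inverse P" by simp
  then show ?thesis using inv by (simp add: mult.commute)
qed

theorem theorem4p2:
  fixes m :: nat and \<alpha> \<alpha>' :: "real list"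
  assumes "m \<ge> 2"
    and "length \<alpha> = m" and "\<forall>a\<in>set \<alpha>. a > 0"
    and "length \<alpha>' = m" and "\<forall>a\<in>set \<alpha>'. a > 0"
  shows "((\<forall>p\<in>{1..m}. Lambda_moment \<alpha> p = Lambda_moment \<alpha>' p) \<longrightarrow> mset \<alpha>' = mset \<alpha>) \<and>
         ((\<forall>k\<in>{m - 1..2 * m - 1}. Lambda_deriv_0 \<alpha> k = Lambda_deriv_0 \<alpha>' k) \<longrightarrow> mset \<alpha>' = mset \<alpha>)"
proof -
  define M where "M \<beta> = Abs_fps (\<lambda>p. Lambda_moment \<beta> p / fact p)" for \<beta>
  define P where "P \<beta> = (\<Prod>i<m. fps_of_poly [:\<beta> ! i, 1:])" for \<beta> :: "real list"
  obtain f where f: "derivative_chain f" "Lambda \<alpha> = (\<lambda>x. if x < 0 then 0 else f 0 x)"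
    "P \<alpha> * Abs_fps (\<lambda>k. f k 0) = fps_X ^ (m - 1)" "(\<Prod>i<m. fps_of_poly [:1, - \<alpha> ! i:]) * M \<alpha> = 1"
    by (rule Lambda_generating_fps[of \<alpha>, unfolded assms(2), folded P_def M_def, OF assms(1,3)])
  obtain f' where f': "derivative_chain f'" "Lambda \<alpha>' = (\<lambda>x. if x < 0 then 0 else f' 0 x)"
    "P \<alpha>' * Abs_fps (\<lambda>k. f' k 0) = fps_X ^ (m - 1)" "(\<Prod>i<m. fps_of_poly [:1, - \<alpha>' ! i:]) * M \<alpha>' = 1"
    by (rule Lambda_generating_fps[of \<alpha>', unfolded assms(4), folded P_def M_def, OF assms(1,5)])
  show ?thesis
  proof (intro conjI impI)
    assume eq: "\<forall>p\<in>{1..m}. Lambda_moment \<alpha> p = Lambda_moment \<alpha>' p"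
    \<comment> \<open>The hypothesis starts at order 1; the zeroth coefficient comes from the
      product identity, as all linear factors have constant term 1.\<close>
    have "M \<alpha> $ 0 = 1" "M \<alpha>' $ 0 = 1"
      using arg_cong[OF f(4), of "\<lambda>F. F $ 0"] arg_cong[OF f'(4), of "\<lambda>F. F $ 0"]
      by (simp_all add: prod_fps_nth_0)
    then have "M \<alpha>' $ p = M \<alpha> $ p" if "p \<le> m" for p
      using eq that by (cases "p = 0") (auto simp: M_def)
    then show "mset \<alpha>' = mset \<alpha>"
      using assms f(4) f'(4)
      by (intro mset_eq_of_reversed_fps_inverse[of _ m _ "M \<alpha>'" "M \<alpha>"]) auto
  next
    assume eq: "\<forall>k\<in>{m - 1..2 * m - 1}. Lambda_deriv_0 \<alpha> k = Lambda_deriv_0 \<alpha>' k"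
    have "P \<beta> $ 0 \<noteq> 0" if "length \<beta> = m" "\<forall>a\<in>set \<beta>. a > 0" for \<beta>
    proof -
      have "\<beta> ! i \<noteq> 0" if "i < m" for i
        using \<open>\<forall>a\<in>set \<beta>. a > 0\<close> \<open>length \<beta> = m\<close> that nth_mem by fastforce
      then show ?thesis by (simp add: P_def prod_fps_nth_0)
    qed
    note nz = this[OF assms(2,3)] this[OF assms(4,5)]
    note inv = fps_shift_mult_eq_1[OF f(3) nz(1)] fps_shift_mult_eq_1[OF f'(3) nz(2)]
    \<comment> \<open>After the shift, coefficients 0 to \<open>m\<close> are the derivatives of
      orders \<open>m - 1\<close> to \<open>2 * m - 1\<close>: exactly the \<open>m + 1\<close>
      values that a polynomial of degree at most \<open>m\<close> calls for.\<close>
    have "f' (k + (m - 1)) 0 = f (k + (m - 1)) 0" if "k \<le> m" for k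
    proof -
      have "k + (m - 1) \<in> {m - 1..2 * m - 1}" using that assms(1) by auto
      with eq show ?thesis
        using Lambda_deriv_0_eq[OF f(1,2)] Lambda_deriv_0_eq[OF f'(1,2)] by metis
    qed
    then show "mset \<alpha>' = mset \<alpha>"
      using assms inv unfolding P_def
      by (intro mset_eq_of_fps_inverse[of _ m _ "fps_shift (m - 1) (Abs_fps (\<lambda>k. f' k 0))"
            "fps_shift (m - 1) (Abs_fps (\<lambda>k. f k 0))"]) auto
  qed
qed

end
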